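(* There is no cellular automaton $F:\Sigma^{\mathbb{Z}^d}\to\Sigma^{\mathbb{Z}^d}$ (for any $d\ge 1$ and any finite nonempty alphabet $\Sigma$) such that every cellular automaton $G:\Delta^{\mathbb{Z}^k}\to\Delta^{\mathbb{Z}^k}$ (for all $k\ge 1$ and all finite nonempty alphabets $\Delta$) is a weak factor of $F$. The same holds if the class of cellular automata $G$ required to be weak factors of $F$ is restricted to the injective ones, to the surjective ones, or to the reversible ones: for each of these three classes, there is no cellular automaton $F$ such that every cellular automaton in the class is a weak factor of $F$.
   Context: A cellular automaton $F:A^{\mathbb{Z}^d}\to A^{\mathbb{Z}^d}$ ($d\ge 1$, $A$ a finite nonempty alphabet) is a map that is continuous for the product topology (with $A$ discrete) and commutes with all spatial shifts of $\mathbb{Z}^d$. It is reversible if it is bijective and its inverse is also a cellular automaton. A cellular automaton $G:\Delta^{\mathbb{Z}^k}\to\Delta^{\mathbb{Z}^k}$ is a weak factor of a cellular automaton $F:\Sigma^{\mathbb{Z}^d}\to\Sigma^{\mathbb{Z}^d}$ if there is a continuous surjection $\pi:\Sigma^{\mathbb{Z}^d}\to\Delta^{\mathbb{Z}^k}$ with $\pi\circ F=G\circ\pi$ (such a $\pi$ is a weak factor map; it is not required to commute with spatial shifts). A cellular automaton $F$ is weakly factor-universal if every cellular automaton $G$ is a weak factor of $F$. *)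

theory Defs
  imports "HOL-Analysis.Analysis"
begin

(* Dimensions and alphabets vary inside the statement (F is fixed while G ranges over all
   dimensions and alphabets), so both are explicit carriers rather than types: a point of Z^d
   is a function on {..<d}, and an alphabet is a finite nonempty set. Self-maps of the
   configuration space are total HOL functions of which only the values on configs matter. *)

definition cells :: "nat \<Rightarrow> (nat \<Rightarrow> int) set" where
  "cells d = ({..<d} \<rightarrow>\<^sub>E UNIV)"

definition cell_add :: "nat \<Rightarrow> (nat \<Rightarrow> int) \<Rightarrow> (nat \<Rightarrow> int) \<Rightarrow> (nat \<Rightarrow> int)" where
  "cell_add d u v = (\<lambda>i\<in>{..<d}. u i + v i)"

type_synonym 'a config = "(nat \<Rightarrow> int) \<Rightarrow> 'a"

definition configs :: "nat \<Rightarrow> 'a set \<Rightarrow> 'a config set" where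
  "configs d A = (cells d \<rightarrow>\<^sub>E A)"

(* The underlying set of this topology is configs d A. *)
definition config_topology :: "nat \<Rightarrow> 'a set \<Rightarrow> 'a config topology" where
  "config_topology d A = product_topology (\<lambda>_. discrete_topology A) (cells d)"

definition shift :: "nat \<Rightarrow> (nat \<Rightarrow> int) \<Rightarrow> 'a config \<Rightarrow> 'a config" where
  "shift d u x = (\<lambda>v\<in>cells d. x (cell_add d v u))"

definition cellular_automaton ::
    "nat \<Rightarrow> 'a set \<Rightarrow> ('a config \<Rightarrow> 'a config) \<Rightarrow> bool" where
  "cellular_automaton d A F \<longleftrightarrow>
     d \<ge> 1 \<and> finite A \<and> A \<noteq> {} \<and>
     continuous_map (config_topology d A) (config_topology d A) F \<and>
     (\<forall>u\<in>cells d. \<forall>x\<in>configs d A. F (shift d u x) = shift d u (F x))"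

definition injective_ca ::
    "nat \<Rightarrow> 'a set \<Rightarrow> ('a config \<Rightarrow> 'a config) \<Rightarrow> bool" where
  "injective_ca d A F \<longleftrightarrow> cellular_automaton d A F \<and> inj_on F (configs d A)"

definition surjective_ca ::
    "nat \<Rightarrow> 'a set \<Rightarrow> ('a config \<Rightarrow> 'a config) \<Rightarrow> bool" where
  "surjective_ca d A F \<longleftrightarrow> cellular_automaton d A F \<and> F ` configs d A = configs d A"

definition reversible_ca ::
    "nat \<Rightarrow> 'a set \<Rightarrow> ('a config \<Rightarrow> 'a config) \<Rightarrow> bool" where
  "reversible_ca d A F \<longleftrightarrow>
     cellular_automaton d A F \<and>
     bij_betw F (configs d A) (configs d A) \<and>
     cellular_automaton d A (inv_into (configs d A) F)"

definition weak_factor_map ::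
    "nat \<Rightarrow> 'b set \<Rightarrow> ('b config \<Rightarrow> 'b config) \<Rightarrow>
     nat \<Rightarrow> 'a set \<Rightarrow> ('a config \<Rightarrow> 'a config) \<Rightarrow>
     ('a config \<Rightarrow> 'b config) \<Rightarrow> bool" where
  "weak_factor_map k B G d A F p \<longleftrightarrow>
     continuous_map (config_topology d A) (config_topology k B) p \<and>
     p ` configs d A = configs k B \<and>
     (\<forall>x\<in>configs d A. p (F x) = G (p x))"

(* G (on B, dimension k) is a weak factor of F (on A, dimension d). *)
definition weak_factor ::
    "nat \<Rightarrow> 'b set \<Rightarrow> ('b config \<Rightarrow> 'b config) \<Rightarrow>
     nat \<Rightarrow> 'a set \<Rightarrow> ('a config \<Rightarrow> 'a config) \<Rightarrow> bool" where
  "weak_factor k B G d A F \<longleftrightarrow> (\<exists>p. weak_factor_map k B G d A F p)"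

(* HOL cannot quantify over types inside a formula. As every finite alphabet is in bijection
   with a finite set of naturals, letting B range over the finite nonempty subsets of nat
   covers all alphabets up to renaming of symbols. *)
definition weakly_factor_universal ::
    "nat \<Rightarrow> 'a set \<Rightarrow> ('a config \<Rightarrow> 'a config) \<Rightarrow> bool" where
  "weakly_factor_universal d A F \<longleftrightarrow>
     (\<forall>k (B :: nat set) G. cellular_automaton k B G \<longrightarrow> weak_factor k B G d A F)"

end

theory Submission
  imports Defs
begin

text \<open>
  A cellular automaton cannot avoid short temporal periods. Being shift-equivariant, it maps
  spatially constant configurations to spatially constant ones, and there are only
  \<^term>\<open>card A\<close> of these; hence some configuration returns to itself after at most
  \<^term>\<open>card A\<close> steps, and at least one
  (\<open>cellular_automaton_short_period\<close>). A weak factor map sends a point with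
  \<open>F^n x = x\<close> to a point with \<open>G^n y = y\<close> (\<open>weak_factor_periodic_point\<close>), so each
  weak factor of \<open>F\<close> has such a period as well. But the automaton that adds 1 modulo
  \<open>q\<close> to every symbol is reversible and has no period strictly between 0 and \<open>q\<close>. For
  \<open>q = card A + 1\<close> it is therefore not a weak factor of \<open>F\<close>. As a reversible automaton is
  also injective and surjective, this one obstruction settles all four classes.
\<close>

section \<open>Configurations and cellular automata\<close>

lemma topspace_config_topology [simp]: "topspace (config_topology d A) = configs d A"
  by (simp add: config_topology_def configs_def)

lemma cell_add_in_cells [simp]: "cell_add d u v \<in> cells d"
  by (simp add: cell_add_def cells_def)

lemma shift_in_configs: "x \<in> configs d A \<Longrightarrow> shift d u x \<in> configs d A"
  by (auto simp: shift_def configs_def)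

lemma cellular_automaton_in_configs:
  "cellular_automaton d A F \<Longrightarrow> x \<in> configs d A \<Longrightarrow> F x \<in> configs d A"
  unfolding cellular_automaton_def using continuous_map_image_subset_topspace by fastforce

lemma cellular_automaton_iterate_in_configs:
  assumes "cellular_automaton d A F" "x \<in> configs d A"
  shows "(F ^^ n) x \<in> configs d A"
  by (induction n) (use assms in \<open>auto intro: cellular_automaton_in_configs\<close>)

lemma cellular_automaton_cong:
  assumes "cellular_automaton d A F" and "\<And>x. x \<in> configs d A \<Longrightarrow> F x = F' x"
  shows "cellular_automaton d A F'"
proof -
  have "continuous_map (config_topology d A) (config_topology d A) F'"
    by (rule continuous_map_eq[of _ _ F]) (use assms in \<open>simp_all add: cellular_automaton_def\<close>)
  moreover have "F' (shift d u x) = shift d u (F' x)" if "u \<in> cells d" "x \<in> configs d A" for u x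
    using assms that shift_in_configs[OF that(2)] by (metis cellular_automaton_def)
  ultimately show ?thesis using assms(1) by (simp add: cellular_automaton_def)
qed

section \<open>Short periods\<close>

text \<open>A constant configuration is fixed by every shift, hence so is its image, and a
  configuration fixed by every shift has the same symbol everywhere as at the origin.\<close>

lemma cellular_automaton_constant_config:
  assumes F: "cellular_automaton d A F" and a: "a \<in> A"
  shows "\<exists>b\<in>A. F (\<lambda>v\<in>cells d. a) = (\<lambda>v\<in>cells d. b)"
proof -
  let ?c = "\<lambda>v\<in>cells d. a"
  let ?o = "\<lambda>i\<in>{..<d}. (0::int)"
  have o: "?o \<in> cells d" by (simp add: cells_def)
  have c: "?c \<in> configs d A" using a by (simp add: configs_def)
  have Fc: "F ?c \<in> cells d \<rightarrow>\<^sub>E A"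
    using cellular_automaton_in_configs[OF F c] by (simp add: configs_def)
  have "F ?c v = F ?c ?o" if v: "v \<in> cells d" for v
  proof -
    have "shift d v ?c = ?c" by (auto simp: shift_def)
    moreover have "F (shift d v ?c) = shift d v (F ?c)"
      using F c v by (simp add: cellular_automaton_def)
    ultimately have "F ?c ?o = shift d v (F ?c) ?o" by simp
    also have "\<dots> = F ?c (cell_add d ?o v)" using o by (simp add: shift_def)
    also have "cell_add d ?o v = v"
      using v by (auto simp: cell_add_def cells_def PiE_def extensional_def)
    finally show ?thesis by (rule sym)
  qed
  then have "F ?c = (\<lambda>v\<in>cells d. F ?c ?o)"
    by (intro extensionalityI[of _ "cells d"])
      (use Fc in \<open>simp_all only: PiE_iff restrict_extensional restrict_apply'\<close>)
  moreover have "F ?c ?o \<in> A" using Fc o by auto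
  ultimately show ?thesis by blast
qed

text \<open>The orbit of a constant configuration stays among the constant ones, so two of its
  first \<^term>\<open>card A + 1\<close> points coincide.\<close>

lemma cellular_automaton_short_period:
  assumes F: "cellular_automaton d A F"
  obtains x n where "x \<in> configs d A" "0 < n" "n \<le> card A" "(F ^^ n) x = x"
proof -
  define C where "C = (\<lambda>a. \<lambda>v\<in>cells d. a) ` A"
  have finA: "finite A" and "A \<noteq> {}" using F by (auto simp: cellular_automaton_def)
  then obtain a where a: "a \<in> A" by blast
  let ?x = "\<lambda>v\<in>cells d. a"
  have "F y \<in> C" if "y \<in> C" for y
    using that cellular_automaton_constant_config[OF F] by (fastforce simp: C_def)
  then have orbit: "(F ^^ n) ?x \<in> C" for n
    by (induction n) (use a in \<open>auto simp: C_def\<close>)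
  have "card C \<le> card A" unfolding C_def by (rule card_image_le[OF finA])
  also have "\<dots> < card {..card A}" by simp
  finally have "\<not> inj_on (\<lambda>n. (F ^^ n) ?x) {..card A}"
    using card_inj_on_le[of "\<lambda>n. (F ^^ n) ?x" "{..card A}" C] orbit finA
    by (auto simp: C_def)
  then obtain i j where ij: "i < j" "j \<le> card A" "(F ^^ i) ?x = (F ^^ j) ?x"
    unfolding inj_on_def by (metis atMost_iff linorder_neqE_nat)
  show thesis
  proof
    show "(F ^^ i) ?x \<in> configs d A"
      using cellular_automaton_iterate_in_configs[OF F] a by (simp add: configs_def)
    show "(F ^^ (j - i)) ((F ^^ i) ?x) = (F ^^ i) ?x"
      using ij by (metis add.commute comp_apply funpow_add le_add_diff_inverse less_imp_le)
  qed (use ij in auto)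
qed

lemma weak_factor_periodic_point:
  assumes F: "cellular_automaton d A F" and "weak_factor k B G d A F"
    and x: "x \<in> configs d A" "(F ^^ n) x = x"
  obtains y where "y \<in> configs k B" "(G ^^ n) y = y"
proof -
  obtain p where p: "p ` configs d A = configs k B"
    "\<And>x. x \<in> configs d A \<Longrightarrow> p (F x) = G (p x)"
    using assms(2) by (auto simp: weak_factor_def weak_factor_map_def)
  have "p ((F ^^ m) x) = (G ^^ m) (p x)" for m
    by (induction m) (use p(2) cellular_automaton_iterate_in_configs[OF F x(1)] in auto)
  then have "(G ^^ n) (p x) = p x" using x(2) by metis
  moreover have "p x \<in> configs k B" using p(1) x(1) by blast
  ultimately show thesis using that by blast
qed

section \<open>Automata acting on each symbol separately\<close>

definition symbolwise :: "nat \<Rightarrow> ('a \<Rightarrow> 'a) \<Rightarrow> 'a config \<Rightarrow> 'a config" where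
  "symbolwise k g y = (\<lambda>v\<in>cells k. g (y v))"

lemma symbolwise_in_configs:
  "g \<in> B \<rightarrow> B \<Longrightarrow> y \<in> configs k B \<Longrightarrow> symbolwise k g y \<in> configs k B"
  by (auto simp: symbolwise_def configs_def)

lemma symbolwise_inverse:
  assumes "\<And>b. b \<in> B \<Longrightarrow> h (g b) = b" and "y \<in> configs k B"
  shows "symbolwise k h (symbolwise k g y) = y"
  using assms by (fastforce simp: symbolwise_def configs_def PiE_def extensional_def)

lemma cellular_automaton_symbolwise:
  assumes k: "k \<ge> 1" and B: "finite B" "B \<noteq> {}" and g: "g \<in> B \<rightarrow> B"
  shows "cellular_automaton k B (symbolwise k g)"
proof -
  have "continuous_map (config_topology k B) (discrete_topology B) (\<lambda>y. g (y v))"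
    if "v \<in> cells k" for v
  proof -
    have "continuous_map (config_topology k B) (discrete_topology B) (\<lambda>y. y v)"
      unfolding config_topology_def using continuous_map_product_projection[OF that] by fastforce
    moreover have "continuous_map (discrete_topology B) (discrete_topology B) g"
      using g by auto
    ultimately show ?thesis
      using continuous_map_compose[of _ _ "\<lambda>y. y v" _ g] by (simp add: comp_def)
  qed
  then have "continuous_map (config_topology k B) (config_topology k B) (symbolwise k g)"
    by (subst (2) config_topology_def) (auto simp: continuous_map_componentwise symbolwise_def)
  moreover have "symbolwise k g (shift k u y) = shift k u (symbolwise k g y)" for u y
    by (auto simp: symbolwise_def shift_def)
  ultimately show ?thesis using k B by (simp add: cellular_automaton_def)
qed

text \<open>The inverse permutation of the symbols, applied symbolwise, agrees with
  \<^const>\<open>inv_into\<close> only on configurations, so it reaches the latter by way of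
  \<open>cellular_automaton_cong\<close>.\<close>

lemma reversible_ca_symbolwise:
  assumes k: "k \<ge> 1" and B: "finite B" "B \<noteq> {}" and g: "bij_betw g B B"
  shows "reversible_ca k B (symbolwise k g)"
proof -
  let ?h = "inv_into B g"
  have gB: "g \<in> B \<rightarrow> B" using g by (auto simp: bij_betw_def)
  have hB: "?h \<in> B \<rightarrow> B" using bij_betw_inv_into[OF g] by (auto simp: bij_betw_def)
  have hg: "symbolwise k ?h (symbolwise k g y) = y" if "y \<in> configs k B" for y
    by (rule symbolwise_inverse[OF _ that]) (use g in \<open>simp add: bij_betw_inv_into_left\<close>)
  have gh: "symbolwise k g (symbolwise k ?h y) = y" if "y \<in> configs k B" for y
    by (rule symbolwise_inverse[OF _ that]) (use g in \<open>simp add: bij_betw_inv_into_right\<close>)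
  have bij: "bij_betw (symbolwise k g) (configs k B) (configs k B)"
    by (rule bij_betw_byWitness[where f' = "symbolwise k ?h"])
      (use hg gh symbolwise_in_configs[OF gB] symbolwise_in_configs[OF hB] in auto)
  have "symbolwise k ?h y = inv_into (configs k B) (symbolwise k g) y"
    if "y \<in> configs k B" for y
    using bij that gh symbolwise_in_configs[OF hB that]
    by (metis bij_betw_inv_into_left)
  then have "cellular_automaton k B (inv_into (configs k B) (symbolwise k g))"
    by (rule cellular_automaton_cong[OF cellular_automaton_symbolwise[OF k B hB]])
  then show ?thesis
    using bij cellular_automaton_symbolwise[OF k B gB] by (simp add: reversible_ca_def)
qed

lemma bij_betw_Suc_mod:
  assumes "q > 0"
  shows "bij_betw (\<lambda>b. Suc b mod q) {..<q} {..<q}"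
proof -
  have "inj_on (\<lambda>b. Suc b mod q) {..<q}"
    by (rule inj_onI) (auto simp: mod_Suc split: if_splits)
  then show ?thesis
    using assms by (intro bij_betw_imageI endo_inj_surj) auto
qed

lemma symbolwise_Suc_mod_no_short_period:
  assumes y: "y \<in> configs k {..<q}" and n: "0 < n" "n < q"
  shows "(symbolwise k (\<lambda>b. Suc b mod q) ^^ n) y \<noteq> y"
proof
  assume period: "(symbolwise k (\<lambda>b. Suc b mod q) ^^ n) y = y"
  obtain v where v: "v \<in> cells k" using cell_add_in_cells by blast
  then have yv: "y v < q" using y by (auto simp: configs_def)
  have "(symbolwise k (\<lambda>b. Suc b mod q) ^^ m) y v = (y v + m) mod q" for m
    by (induction m) (use v yv in \<open>auto simp: symbolwise_def mod_Suc_eq\<close>)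
  then have "(y v + n) mod q = y v" using period by metis
  moreover have "(y v + n) mod q = (if y v + n < q then y v + n else y v + n - q)"
    using n yv by (simp add: le_mod_geq)
  ultimately show False using n yv by (simp split: if_splits)
qed

section \<open>No universal cellular automaton\<close>

lemma reversible_non_weak_factor:
  assumes F: "cellular_automaton d A F"
  obtains k and B :: "nat set" and G where "reversible_ca k B G" "\<not> weak_factor k B G d A F"
proof
  let ?q = "Suc (card A)"
  let ?G = "symbolwise 1 (\<lambda>b. Suc b mod ?q)"
  show "reversible_ca 1 {..<?q} ?G"
    by (rule reversible_ca_symbolwise) (use bij_betw_Suc_mod[of ?q] in auto)
  show "\<not> weak_factor 1 {..<?q} ?G d A F"
  proof
    assume wf: "weak_factor 1 {..<?q} ?G d A F"
    obtain x n where x: "x \<in> configs d A" "0 < n" "n \<le> card A" "(F ^^ n) x = x"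
      using cellular_automaton_short_period[OF F] .
    obtain y where "y \<in> configs 1 {..<?q}" "(?G ^^ n) y = y"
      using weak_factor_periodic_point[OF F wf x(1,4)] .
    then show False using symbolwise_Suc_mod_no_short_period[of y 1 ?q n] x(2,3) by simp
  qed
qed

lemma reversible_ca_imp_cellular_automaton: "reversible_ca k B G \<Longrightarrow> cellular_automaton k B G"
  by (simp add: reversible_ca_def)

lemma reversible_ca_imp_injective_ca: "reversible_ca k B G \<Longrightarrow> injective_ca k B G"
  by (simp add: reversible_ca_def injective_ca_def bij_betw_def)

lemma reversible_ca_imp_surjective_ca: "reversible_ca k B G \<Longrightarrow> surjective_ca k B G"
  by (simp add: reversible_ca_def surjective_ca_def bij_betw_def)

theorem corollary2p2:
  "(\<not> (\<exists>d (A :: 'a set) F. cellular_automaton d A F \<and> weakly_factor_universal d A F)) \<and>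
   (\<not> (\<exists>d (A :: 'a set) F. cellular_automaton d A F \<and>
          (\<forall>k (B :: nat set) G. injective_ca k B G \<longrightarrow> weak_factor k B G d A F))) \<and>
   (\<not> (\<exists>d (A :: 'a set) F. cellular_automaton d A F \<and>
          (\<forall>k (B :: nat set) G. surjective_ca k B G \<longrightarrow> weak_factor k B G d A F))) \<and>
   (\<not> (\<exists>d (A :: 'a set) F. cellular_automaton d A F \<and>
          (\<forall>k (B :: nat set) G. reversible_ca k B G \<longrightarrow> weak_factor k B G d A F)))"
proof -
  have *: False
    if "cellular_automaton d A F"
      and "\<And>k (B :: nat set) G. reversible_ca k B G \<Longrightarrow> weak_factor k B G d A F"
    for d and A :: "'a set" and F
    using reversible_non_weak_factor[OF that(1)] that(2) by blast
  show ?thesis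
  proof (intro conjI notI; elim exE conjE)
    fix d and A :: "'a set" and F
    assume F: "cellular_automaton d A F"
    show False if "weakly_factor_universal d A F"
      using *[OF F] that reversible_ca_imp_cellular_automaton
      unfolding weakly_factor_universal_def by blast
    show False if "\<forall>k (B :: nat set) G. injective_ca k B G \<longrightarrow> weak_factor k B G d A F"
      using *[OF F] that reversible_ca_imp_injective_ca by blast
    show False if "\<forall>k (B :: nat set) G. surjective_ca k B G \<longrightarrow> weak_factor k B G d A F"
      using *[OF F] that reversible_ca_imp_surjective_ca by blast
    show False if "\<forall>k (B :: nat set) G. reversible_ca k B G \<longrightarrow> weak_factor k B G d A F"
      using *[OF F] that by blast
  qed
qed

end
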